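(* Let $K,T>0$, $n\in(0,\infty]$, let $G=(V,w,m)$ be a finite measured weighted graph, and let $\rho\colon V\to\mathbb{R}$ be such that $G$ satisfies $CD(\rho,n)$ and $$k_T((\rho-K)_-)\le\frac14\left(1-e^{-KT/2}\right).$$ Then for any eigenfunction $f$ of $L$ in $L^2(V)$ with eigenvalue $\lambda$, $$\|\Gamma f\|_\infty\le 2e^{1+TK}\,\lambda\,\|f\|_\infty^2.$$
   Context: A measured weighted graph (mwg) $G=(V,w,m)$ consists of a countable set $V$, a symmetric function $w\colon V\times V\to[0,\infty)$ vanishing on the diagonal, and a function $m\colon V\to(0,\infty)$. All mwg are assumed locally finite (for each $x\in V$ the set $\{y: w(x,y)>0\}$ is finite) and connected. It is finite if $V$ is finite. Write $q(x,y)=w(x,y)/m(x)$. $L^2(V)$ carries the inner product $\langle f,g\rangle=\sum_{x}m(x)f(x)g(x)$. For $f\colon V\to\mathbb{R}$ the Laplacian is $\Delta f(x)=\sum_{y}q(x,y)(f(y)-f(x))$, $L=-\Delta\ge0$, and $P_t=e^{-tL}$, $t\ge0$, is the heat semigroup. For bounded $f,g\colon V\to\mathbb{R}$: $\Gamma(f,g)=\frac12(\Delta(fg)-f\Delta g-g\Delta f)$ and $\Gamma_2(f,g)=\frac12(\Delta\Gamma(f,g)-\Gamma(f,\Delta g)-\Gamma(g,\Delta f))$; $\Gamma f:=\Gamma(f,f)$, $\Gamma_2f:=\Gamma_2(f,f)$. $G$ satisfies $CD(\rho,n)$ if for all bounded $f\colon V\to\mathbb{R}$ and all $x\in V$: $\Gamma_2f(x)\ge\rho(x)\Gamma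 f(x)+\frac1n(\Delta f(x))^2$ (with $\frac1\infty=0$). For $a\in\mathbb{R}$, $a_-:=-\min\{0,a\}$. For $W\colon V\to[0,\infty)$ and $T>0$, $k_T(W):=\sup_{j\in\mathbb{N}}\int_0^T\|P_t(j\wedge W)\|_\infty\,dt$, where $j\wedge W$ is the pointwise minimum. *)

theory Defs
  imports "HOL-Analysis.Analysis"
begin

text \<open>The vertex set is the whole type \<open>'v\<close>. Finite graphs are those over a type of class
  \<open>finite\<close>.\<close>

locale mwg =
  fixes w :: "'v \<Rightarrow> 'v \<Rightarrow> real" and m :: "'v \<Rightarrow> real"
  assumes countable_vertices: "countable (UNIV :: 'v set)"
    and weight_nonneg: "w x y \<ge> 0"
    and weight_sym: "w x y = w y x"
    and weight_diag: "w x x = 0"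
    and measure_pos: "m x > 0"
    and locally_finite: "finite {y. w x y > 0}"
    and connected: "(\<lambda>a b. w a b > 0)\<^sup>*\<^sup>* x y"

definition rate :: "('v \<Rightarrow> 'v \<Rightarrow> real) \<Rightarrow> ('v \<Rightarrow> real) \<Rightarrow> 'v \<Rightarrow> 'v \<Rightarrow> real" where
  "rate w m x y = w x y / m x"

text \<open>Only neighbours of \<open>x\<close> contribute to the Laplacian; summing over them keeps the sum finite
  on every locally finite graph.\<close>

definition laplacian ::
    "('v \<Rightarrow> 'v \<Rightarrow> real) \<Rightarrow> ('v \<Rightarrow> real) \<Rightarrow> ('v \<Rightarrow> real) \<Rightarrow> 'v \<Rightarrow> real" where
  "laplacian w m f x = (\<Sum>y | w x y > 0. rate w m x y * (f y - f x))"

definition neg_laplacian ::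
    "('v \<Rightarrow> 'v \<Rightarrow> real) \<Rightarrow> ('v \<Rightarrow> real) \<Rightarrow> ('v \<Rightarrow> real) \<Rightarrow> 'v \<Rightarrow> real" where
  "neg_laplacian w m f = (\<lambda>x. - laplacian w m f x)"

definition Gamma_form ::
    "('v \<Rightarrow> 'v \<Rightarrow> real) \<Rightarrow> ('v \<Rightarrow> real) \<Rightarrow> ('v \<Rightarrow> real) \<Rightarrow> ('v \<Rightarrow> real) \<Rightarrow> 'v \<Rightarrow> real" where
  "Gamma_form w m f g x = (1/2) * (laplacian w m (\<lambda>z. f z * g z) x
     - f x * laplacian w m g x - g x * laplacian w m f x)"

definition Gamma2_form ::
    "('v \<Rightarrow> 'v \<Rightarrow> real) \<Rightarrow> ('v \<Rightarrow> real) \<Rightarrow> ('v \<Rightarrow> real) \<Rightarrow> ('v \<Rightarrow> real) \<Rightarrow> 'v \<Rightarrow> real" where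
  "Gamma2_form w m f g x = (1/2) * (laplacian w m (Gamma_form w m f g) x
     - Gamma_form w m f (laplacian w m g) x - Gamma_form w m g (laplacian w m f) x)"

text \<open>For \<open>n = \<infinity>\<close> the last term vanishes, since \<open>1 / \<infinity> = 0\<close> in \<open>ereal\<close>.\<close>

definition CD ::
    "('v \<Rightarrow> 'v \<Rightarrow> real) \<Rightarrow> ('v \<Rightarrow> real) \<Rightarrow> ('v \<Rightarrow> real) \<Rightarrow> ereal \<Rightarrow> bool" where
  "CD w m \<rho> n \<longleftrightarrow> (\<forall>f x. bounded (range f) \<longrightarrow>
     Gamma2_form w m f f x
       \<ge> \<rho> x * Gamma_form w m f f x + real_of_ereal (1 / n) * (laplacian w m f x)\<^sup>2)"

definition L2 :: "('v \<Rightarrow> real) \<Rightarrow> ('v \<Rightarrow> real) set" where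
  "L2 m = {f. (\<lambda>x. m x * (f x)\<^sup>2) summable_on UNIV}"

definition eigenfunction ::
    "('v \<Rightarrow> 'v \<Rightarrow> real) \<Rightarrow> ('v \<Rightarrow> real) \<Rightarrow> real \<Rightarrow> ('v \<Rightarrow> real) \<Rightarrow> bool" where
  "eigenfunction w m l f \<longleftrightarrow>
     f \<in> L2 m \<and> f \<noteq> (\<lambda>_. 0) \<and> neg_laplacian w m f = (\<lambda>x. l * f x)"

text \<open>On a finite graph \<open>L = neg_laplacian w m\<close> acts on a finite-dimensional space, so
  \<open>e\<^sup>-\<^sup>t\<^sup>L\<close> is the operator exponential series, which may be evaluated pointwise.
  The supremum norm, too, is only used on finite graphs, where the supremum of reals is attained.\<close>

definition heat ::
    "('v::finite \<Rightarrow> 'v \<Rightarrow> real) \<Rightarrow> ('v \<Rightarrow> real) \<Rightarrow> real \<Rightarrow> ('v \<Rightarrow> real) \<Rightarrow> 'v \<Rightarrow> real" where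
  "heat w m t f x = (\<Sum>k. (- t) ^ k / fact k * ((neg_laplacian w m ^^ k) f) x)"

definition sup_norm :: "('v::finite \<Rightarrow> real) \<Rightarrow> real" where
  "sup_norm f = (SUP x. \<bar>f x\<bar>)"

definition neg_part :: "real \<Rightarrow> real" where
  "neg_part a = - min 0 a"

definition kato ::
    "('v::finite \<Rightarrow> 'v \<Rightarrow> real) \<Rightarrow> ('v \<Rightarrow> real) \<Rightarrow> real \<Rightarrow> ('v \<Rightarrow> real) \<Rightarrow> ennreal" where
  "kato w m T W = (SUP j::nat. \<integral>\<^sup>+ t\<in>{0..T}.
     ennreal (sup_norm (heat w m t (\<lambda>x. min (real j) (W x)))) \<partial>lborel)"

end

theory Submission
  imports Defs
begin

text \<open>
  Write \<open>\<lambda>\<close> for the eigenvalue \<open>l\<close>, and let \<open>W = (\<rho> - K)\<^sub>-\<close>, \<open>g = \<Gamma> f\<close> and \<open>M = \<parallel>f\<parallel>\<^sub>\<infinity>\<^sup>2\<close>.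
  Since \<open>\<Delta> f = - \<lambda> f\<close>, the curvature condition says that \<open>\<Delta> g \<ge> 2 (K - W - \<lambda>) g\<close>,
  and the definition of \<open>\<Gamma>\<close> says that \<open>\<Delta> f\<^sup>2 = 2 g - 2 \<lambda> f\<^sup>2\<close>
  (\<open>eigenfunction_bochner\<close>). Adding a large multiple of \<open>f\<^sup>2\<close> to \<open>g\<close> turns the possibly very negative
  zeroth-order coefficient \<open>2 (K - \<lambda>)\<close> into a positive one: \<open>u = g + 2 \<lambda> f\<^sup>2\<close> satisfies
  \[ (2 K + 2 \<lambda> - 2 W) u - \<Delta> u \<le> 4 \<lambda> (K + 2 \<lambda>) M. \]
  If \<open>W\<close> were zero, evaluating this at a maximum of \<open>u\<close> would bound \<open>g \<le> u\<close> at once.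

  The potential \<open>W\<close> is absorbed by a ground-state substitution. If the Kato constant of \<open>W\<close> over
  \<open>[0, T]\<close> is at most \<open>k\<close>, there is a function \<open>\<phi>\<close> with \<open>1 - 2 k \<le> \<phi> \<le> 1\<close> and
  \<open>\<Delta> \<phi> + 2 W \<phi> \<le> 2 k / T\<close> (\<open>kato_supersolution\<close>). It is an affine function of
  \<open>\<psi> = \<integral>\<^sub>0\<^sup>T (1 - t / T) P\<^sub>t W dt\<close>: the linear cutoff keeps everything on the interval
  \<open>[0, T]\<close> that the hypothesis controls, and leaves \<open>\<Delta> \<psi> = - W + (1 / T) \<integral>\<^sub>0\<^sup>T P\<^sub>t W dt\<close>, an error of at most
  \<open>k / T\<close>. The lower bound \<open>\<psi> \<ge> 0\<close> comes from positivity of the heat semigroup.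

  At a maximum of \<open>u / \<phi>\<close> the terms with \<open>W\<close> cancel (\<open>supersolution_comparison\<close>), which gives
  \[ g \<le> 4 \<lambda> (K + 2 \<lambda>) M / (2 (K + \<lambda>) (1 - 2 k) - 2 k / T). \]
  For \<open>k = (1 - y) / 4\<close> with \<open>y = e\<^sup>-\<^sup>K\<^sup>T\<^sup>/\<^sup>2\<close> the denominator is at least \<open>(K + 2 \<lambda>) y\<^sup>2\<close>, so
  \<open>g \<le> 4 e\<^sup>K\<^sup>T \<lambda> M\<close>, which is within the asserted bound because \<open>4 \<le> 2 e\<close>.
\<close>

section \<open>The Laplacian on a finite graph\<close>

lemma finite_type_attains_max:
  fixes h :: "'v::finite \<Rightarrow> real"
  obtains z where "\<And>y. h y \<le> h z"
proof -
  have "Max (range h) \<in> range h"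
    by (intro Max_in) auto
  then obtain z where "h z = Max (range h)"
    by (metis imageE)
  then have "\<And>y. h y \<le> h z" by simp
  then show thesis using that by blast
qed

lemma laplacian_affine_combination:
  "laplacian w m (\<lambda>z. c + a * f z + b * g z) x = a * laplacian w m f x + b * laplacian w m g x"
proof -
  have "laplacian w m (\<lambda>z. c + a * f z + b * g z) x
      = (\<Sum>y | w x y > 0. a * (rate w m x y * (f y - f x)) + b * (rate w m x y * (g y - g x)))"
    unfolding laplacian_def by (intro sum.cong) (auto simp: algebra_simps)
  then show ?thesis
    by (simp add: laplacian_def sum.distrib sum_distrib_left)
qed

lemma rate_nonneg:
  assumes "mwg w m"
  shows "rate w m x y \<ge> 0"
  using mwg.weight_nonneg[OF assms, of x y] mwg.measure_pos[OF assms, of x]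
  by (simp add: rate_def)

lemma laplacian_le_at_contact_point:
  assumes "mwg w m" and "\<And>y. f y \<le> g y" and "f x = g x"
  shows "laplacian w m f x \<le> laplacian w m g x"
  unfolding laplacian_def using assms
  by (intro sum_mono mult_left_mono) (auto simp: rate_nonneg)

lemma laplacian_at_max_nonpos:
  assumes "mwg w m" and "\<And>y. f y \<le> f x"
  shows "laplacian w m f x \<le> 0"
  unfolding laplacian_def using assms
  by (intro sum_nonpos mult_nonneg_nonpos) (auto simp: rate_nonneg)

lemma laplacian_at_min_nonneg:
  assumes "mwg w m" and "\<And>y. f x \<le> f y"
  shows "laplacian w m f x \<ge> 0"
  unfolding laplacian_def using assms
  by (intro sum_nonneg mult_nonneg_nonneg) (auto simp: rate_nonneg)

lemma Gamma_form_self_nonneg: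
  assumes "mwg w m"
  shows "Gamma_form w m f f x \<ge> 0"
proof -
  have "Gamma_form w m f f x = (1/2) * (\<Sum>y | w x y > 0. rate w m x y * (f y - f x)\<^sup>2)"
    unfolding Gamma_form_def laplacian_def
    by (simp add: sum_distrib_left flip: sum_subtractf)
       (auto intro!: sum.cong simp: algebra_simps power2_eq_square)
  also have "\<dots> \<ge> 0"
    using rate_nonneg[OF assms] by (auto intro!: sum_nonneg)
  finally show ?thesis .
qed

section \<open>The heat semigroup\<close>

text \<open>Boundedness in the supremum norm gives the exponential series an infinite radius of
  convergence.\<close>

lemma neg_laplacian_bounded:
  fixes w :: "'v::finite \<Rightarrow> 'v \<Rightarrow> real"
  shows "\<exists>C. \<forall>f B x. (\<forall>y. \<bar>f y\<bar> \<le> B) \<longrightarrow> \<bar>neg_laplacian w m f x\<bar> \<le> C * B"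
proof -
  define C where "C = (\<Sum>x\<in>UNIV. \<Sum>y\<in>UNIV. \<bar>rate w m x y\<bar> * 2)"
  have "\<bar>neg_laplacian w m f x\<bar> \<le> C * B" if f: "\<And>y. \<bar>f y\<bar> \<le> B" for f B x
  proof -
    have B: "B \<ge> 0" using f by (meson abs_ge_zero order_trans)
    have "\<bar>neg_laplacian w m f x\<bar> \<le> (\<Sum>y | w x y > 0. \<bar>rate w m x y * (f y - f x)\<bar>)"
      unfolding neg_laplacian_def laplacian_def by (simp add: sum_abs)
    also have "\<dots> \<le> (\<Sum>y\<in>UNIV. \<bar>rate w m x y * (f y - f x)\<bar>)"
      by (intro sum_mono2) auto
    also have "\<dots> \<le> (\<Sum>y\<in>UNIV. \<bar>rate w m x y\<bar> * 2 * B)"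
    proof (intro sum_mono)
      fix y
      have "\<bar>f y - f x\<bar> \<le> 2 * B" using f[of x] f[of y] by linarith
      then show "\<bar>rate w m x y * (f y - f x)\<bar> \<le> \<bar>rate w m x y\<bar> * 2 * B"
        by (simp add: abs_mult mult.assoc mult_left_mono)
    qed
    also have "\<dots> = (\<Sum>y\<in>UNIV. \<bar>rate w m x y\<bar> * 2) * B"
      by (simp add: sum_distrib_right)
    also have "\<dots> \<le> C * B"
      unfolding C_def using B
      by (intro mult_right_mono member_le_sum[where f = "\<lambda>x. \<Sum>y\<in>UNIV. \<bar>rate w m x y\<bar> * 2"])
         (auto intro!: sum_nonneg)
    finally show ?thesis .
  qed
  then show ?thesis by (intro exI[of _ C]) simp
qed

lemma heat_series_summable:
  fixes w :: "'v::finite \<Rightarrow> 'v \<Rightarrow> real"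
  shows "summable (\<lambda>k. (- t) ^ k / fact k * ((neg_laplacian w m ^^ k) f) x)"
proof -
  obtain C where
    C: "\<forall>f B x. (\<forall>y. \<bar>f y\<bar> \<le> B) \<longrightarrow> \<bar>neg_laplacian w m f x\<bar> \<le> C * B"
    using neg_laplacian_bounded[of w m] ..
  define B where "B = (\<Sum>x\<in>UNIV. \<bar>f x\<bar>)"
  have iter: "\<bar>((neg_laplacian w m ^^ k) f) x\<bar> \<le> C ^ k * B" for k x
  proof (induction k arbitrary: x)
    case 0
    show ?case unfolding B_def by (auto intro!: member_le_sum[where f = "\<lambda>x. \<bar>f x\<bar>"])
  next
    case (Suc k)
    have "\<bar>neg_laplacian w m ((neg_laplacian w m ^^ k) f) x\<bar> \<le> C * (C ^ k * B)"
      using C Suc.IH by blast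
    then show ?case by (simp add: mult.assoc)
  qed
  show ?thesis
  proof (rule summable_comparison_test)
    show "summable (\<lambda>k. (inverse (fact k) * (\<bar>t\<bar> * C) ^ k) * B)"
      by (intro summable_mult2 summable_exp)
    have "norm ((- t) ^ k / fact k * ((neg_laplacian w m ^^ k) f) x)
        \<le> inverse (fact k) * (\<bar>t\<bar> * C) ^ k * B" for k
    proof -
      have "norm ((- t) ^ k / fact k * ((neg_laplacian w m ^^ k) f) x)
          = inverse (fact k) * \<bar>t\<bar> ^ k * \<bar>((neg_laplacian w m ^^ k) f) x\<bar>"
        by (simp add: abs_mult power_abs field_simps)
      also have "\<dots> \<le> inverse (fact k) * \<bar>t\<bar> ^ k * (C ^ k * B)"
        by (intro mult_left_mono iter) auto
      finally show ?thesis by (simp add: power_mult_distrib mult_ac)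
    qed
    then show "\<exists>N. \<forall>k\<ge>N. norm ((- t) ^ k / fact k * ((neg_laplacian w m ^^ k) f) x)
        \<le> inverse (fact k) * (\<bar>t\<bar> * C) ^ k * B" by blast
  qed
qed

lemma heat_zero:
  fixes w :: "'v::finite \<Rightarrow> 'v \<Rightarrow> real"
  shows "heat w m 0 f x = f x"
proof -
  have "(\<lambda>k. (- 0) ^ k / fact k * ((neg_laplacian w m ^^ k) f) x)
      = (\<lambda>k. (((neg_laplacian w m ^^ k) f) x / fact k) * 0 ^ k)"
    by (auto simp: fun_eq_iff)
  then show ?thesis
    unfolding heat_def by (simp only: powser_zero) simp
qed

lemma laplacian_heat:
  fixes w :: "'v::finite \<Rightarrow> 'v \<Rightarrow> real"
  shows "laplacian w m (heat w m t f) x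
    = (\<Sum>k. (- t) ^ k / fact k * laplacian w m ((neg_laplacian w m ^^ k) f) x)"
proof -
  let ?a = "\<lambda>z k. (- t) ^ k / fact k * ((neg_laplacian w m ^^ k) f) z"
  have "(\<lambda>k. \<Sum>y | w x y > 0. rate w m x y * (?a y k - ?a x k)) sums
      (\<Sum>y | w x y > 0. rate w m x y * (heat w m t f y - heat w m t f x))"
    unfolding heat_def
    by (intro sums_sum sums_mult sums_diff summable_sums heat_series_summable)
  moreover have "(\<Sum>y | w x y > 0. rate w m x y * (?a y k - ?a x k))
      = (- t) ^ k / fact k * laplacian w m ((neg_laplacian w m ^^ k) f) x" for k
    unfolding laplacian_def sum_distrib_left by (intro sum.cong) (auto simp: algebra_simps)
  ultimately show ?thesis
    unfolding laplacian_def[of w m "heat w m t f"] by (simp add: sums_iff)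
qed

lemma heat_equation:
  fixes w :: "'v::finite \<Rightarrow> 'v \<Rightarrow> real"
  shows "((\<lambda>t. heat w m t f x) has_real_derivative laplacian w m (heat w m t f) x) (at t)"
proof -
  define c where "c k = (- 1) ^ k / fact k * ((neg_laplacian w m ^^ k) f) x" for k
  have c: "c k * s ^ k = (- s) ^ k / fact k * ((neg_laplacian w m ^^ k) f) x" for k s
    by (simp add: c_def power_minus[of s])
  have "((\<lambda>t. \<Sum>k. c k * t ^ k) has_real_derivative (\<Sum>k. diffs c k * t ^ k)) (at t)"
    using heat_series_summable[of _ w m f x]
    by (intro termdiffs_strong_converges_everywhere) (simp add: c)
  moreover have "diffs c k * t ^ k
      = (- t) ^ k / fact k * laplacian w m ((neg_laplacian w m ^^ k) f) x" for k
  proof -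
    have "c (Suc k) = - ((- 1) ^ k) / (real (Suc k) * fact k)
        * (- laplacian w m ((neg_laplacian w m ^^ k) f) x)"
      by (simp add: c_def neg_laplacian_def)
    then show ?thesis
      by (simp add: diffs_def power_minus[of t] del: of_nat_Suc)
  qed
  ultimately show ?thesis
    by (simp add: c laplacian_heat heat_def)
qed

text \<open>The parabolic minimum principle. The small slope \<open>d\<close> in time makes the perturbed function a
  strict supersolution, so that its minimum over space and time can only be at time zero; the
  perturbation then tends to zero.\<close>

lemma heat_nonneg:
  fixes w :: "'v::finite \<Rightarrow> 'v \<Rightarrow> real"
  assumes G: "mwg w m" and f: "\<And>y. f y \<ge> 0" and "t \<ge> 0"
  shows "heat w m t f x \<ge> 0"
proof (rule field_le_epsilon)
  fix e :: real
  assume "e > 0"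
  define d where "d = e / (t + 1)"
  have d: "d > 0" "d * t \<le> e"
    using \<open>e > 0\<close> \<open>t \<ge> 0\<close> by (auto simp: d_def field_simps)
  define v where "v s y = heat w m s f y + d * s" for s y
  have deriv: "((\<lambda>s. v s y) has_real_derivative laplacian w m (heat w m s f) y + d) (at s)" for s y
    unfolding v_def by (auto intro!: derivative_eq_intros heat_equation)
  have "\<exists>s\<in>{0..t}. \<forall>s'\<in>{0..t}. v s y \<le> v s' y" for y
    using \<open>t \<ge> 0\<close> deriv
    by (intro continuous_attains_inf compact_Icc)
       (auto intro!: DERIV_isCont continuous_at_imp_continuous_on)
  then obtain \<tau> where \<tau>: "\<And>y. \<tau> y \<in> {0..t}" "\<And>y s'. s' \<in> {0..t} \<Longrightarrow> v (\<tau> y) y \<le> v s' y"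
    by metis
  obtain z where z: "\<And>y. v (\<tau> z) z \<le> v (\<tau> y) y"
    using finite_type_attains_max[of "\<lambda>y. - v (\<tau> y) y"] by auto
  define s where "s = \<tau> z"
  have s: "s \<in> {0..t}" using \<tau>(1) by (simp add: s_def)
  have min: "v s z \<le> v s' y" if "s' \<in> {0..t}" for s' y
    using z[of y] \<tau>(2)[OF that, of y] by (simp add: s_def)
  \<comment> \<open>At a minimum with positive time \<open>v\<close> would be strictly increasing in time, so it would be
    smaller slightly earlier.\<close>
  have "v s z \<ge> 0"
  proof (cases "s = 0")
    case True
    then show ?thesis using f[of z] by (simp add: v_def heat_zero)
  next
    case False
    have "heat w m s f z \<le> heat w m s f y" for y
      using min[OF s, of y] by (simp add: v_def)
    then have "laplacian w m (heat w m s f) z + d > 0"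
      using laplacian_at_min_nonneg[OF G, of "heat w m s f" z] d(1) by simp
    then obtain \<delta> where \<delta>: "\<delta> > 0" "\<And>h. 0 < h \<Longrightarrow> h < \<delta> \<Longrightarrow> v (s - h) z < v s z"
      using DERIV_pos_inc_left[OF deriv] by blast
    have "0 < min \<delta> s / 2" "min \<delta> s / 2 < \<delta>" "s - min \<delta> s / 2 \<in> {0..t}"
      using \<delta>(1) s False by (auto simp: min_def)
    then show ?thesis
      using \<delta>(2)[of "min \<delta> s / 2"] min[of "s - min \<delta> s / 2" z] by linarith
  qed
  also have "v s z \<le> v t x"
    using min \<open>t \<ge> 0\<close> by simp
  also have "\<dots> \<le> heat w m t f x + e"
    using d(2) by (simp add: v_def)
  finally show "0 \<le> heat w m t f x + e" .
qed

section \<open>A supersolution from the Kato condition\<close>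

lemma abs_le_sup_norm:
  fixes f :: "'v::finite \<Rightarrow> real"
  shows "\<bar>f x\<bar> \<le> sup_norm f"
  unfolding sup_norm_def by (intro cSUP_upper) auto

text \<open>Finiteness of the graph makes \<open>W\<close> bounded, so one of the truncations \<open>j \<and> W\<close> in the
  Kato constant is \<open>W\<close> itself.\<close>

lemma heat_integral_le_kato:
  fixes w :: "'v::finite \<Rightarrow> 'v \<Rightarrow> real"
  assumes G: "mwg w m" and W: "\<And>y. W y \<ge> 0" and "k \<ge> 0"
    and kato: "kato w m T W \<le> ennreal k"
    and I: "((\<lambda>t. heat w m t W x) has_integral I) {0..T}"
  shows "I \<le> k"
proof -
  obtain j :: nat where j: "real j \<ge> Max (range W)"
    using real_arch_simple by blast
  have "W y \<le> Max (range W)" for y by simp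
  then have minW: "(\<lambda>x. min (real j) (W x)) = W"
    using j by (auto simp: fun_eq_iff min_def intro: antisym order_trans)
  have pos: "heat w m t W x \<ge> 0" if "t \<in> {0..T}" for t
    using heat_nonneg[OF G W] that by simp
  have "ennreal I = (\<integral>\<^sup>+ t. ennreal (heat w m t W x) * indicator {0..T} t \<partial>lborel)"
    using nn_integral_has_integral_lebesgue'[OF pos I] by simp
  also have "\<dots> \<le> (\<integral>\<^sup>+ t\<in>{0..T}.
     ennreal (sup_norm (heat w m t (\<lambda>x. min (real j) (W x)))) \<partial>lborel)"
    unfolding minW
    by (intro nn_integral_mono mult_right_mono ennreal_leI)
       (auto intro: order_trans[OF abs_ge_self abs_le_sup_norm])
  also have "\<dots> \<le> kato w m T W"
    unfolding kato_def by (intro SUP_upper) auto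
  also note kato
  finally show ?thesis using \<open>k \<ge> 0\<close> by simp
qed

text \<open>The witness is \<open>\<phi> = 1 - 2 k + 2 \<psi>\<close> with \<open>\<psi> = \<integral>\<^sub>0\<^sup>T (1 - t / T) P\<^sub>t W dt\<close>. Integrating by
  parts in time against \<open>\<partial>\<^sub>t P\<^sub>t W = \<Delta> P\<^sub>t W\<close> yields \<open>\<Delta> \<psi>\<close>; the boundary term at \<open>T\<close>
  vanishes because the weight does. As \<open>0 \<le> \<psi> \<le> k\<close>, the shift by \<open>1 - 2 k\<close> puts the maximum of
  \<open>\<phi>\<close> at most at 1, which is what lets \<open>2 \<Delta> \<psi>\<close>, with its \<open>- 2 W\<close>, dominate \<open>2 W \<phi>\<close>.\<close>

lemma kato_supersolution:
  fixes w :: "'v::finite \<Rightarrow> 'v \<Rightarrow> real"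
  assumes G: "mwg w m" and W: "\<And>y. W y \<ge> 0" and "T > 0" and "k \<ge> 0"
    and kato: "kato w m T W \<le> ennreal k"
  obtains \<phi> where "\<And>x. 1 - 2 * k \<le> \<phi> x" "\<And>x. \<phi> x \<le> 1"
    "\<And>x. laplacian w m \<phi> x + 2 * W x * \<phi> x \<le> 2 * k / T"
proof -
  let ?u = "\<lambda>t. heat w m t W"
  let ?g = "\<lambda>x t. (1 - t / T) * ?u t x"
  have cont: "continuous_on {0..T} (\<lambda>t. ?u t x)" for x
    by (intro continuous_at_imp_continuous_on) (auto intro: DERIV_isCont heat_equation)
  define I where "I x = integral {0..T} (\<lambda>t. ?u t x)" for x
  define \<psi> where "\<psi> x = integral {0..T} (?g x)" for x
  have I: "((\<lambda>t. ?u t x) has_integral I x) {0..T}" for x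
    unfolding I_def by (intro integrable_integral integrable_continuous_interval cont)
  have \<psi>: "(?g x has_integral \<psi> x) {0..T}" for x
    unfolding \<psi>_def using \<open>T > 0\<close>
    by (intro integrable_integral integrable_continuous_interval continuous_intros cont) auto
  have u_nonneg: "?u t x \<ge> 0" if "t \<in> {0..T}" for t x
    using heat_nonneg[OF G W] that by simp
  have I_le: "I x \<le> k" for x
    using heat_integral_le_kato[OF G W \<open>k \<ge> 0\<close> kato I] .
  have \<psi>_nonneg: "\<psi> x \<ge> 0" for x
    using \<open>T > 0\<close> u_nonneg
    by (intro has_integral_nonneg[OF \<psi>]) (auto intro!: mult_nonneg_nonneg)
  have "\<psi> x \<le> I x" for x
    using \<open>T > 0\<close> u_nonneg
    by (intro has_integral_le[OF \<psi> I]) (auto intro!: mult_left_le_one_le)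
  then have \<psi>_le: "\<psi> x \<le> k" for x
    using I_le order_trans by blast
  have lap: "laplacian w m \<psi> x = - W x + I x / T" for x
  proof (rule has_integral_unique)
    show "((\<lambda>t. (1 - t / T) * laplacian w m (?u t) x) has_integral laplacian w m \<psi> x) {0..T}"
    proof -
      have "((\<lambda>t. \<Sum>y | w x y > 0. rate w m x y * (?g y t - ?g x t)) has_integral
          laplacian w m \<psi> x) {0..T}"
        unfolding laplacian_def
        by (intro has_integral_sum has_integral_mult_right has_integral_diff \<psi>) auto
      moreover have "(\<Sum>y | w x y > 0. rate w m x y * (?g y t - ?g x t))
          = (1 - t / T) * laplacian w m (?u t) x" for t
        unfolding laplacian_def sum_distrib_left by (intro sum.cong) (auto simp: algebra_simps)
      ultimately show ?thesis by simp
    qed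
    have "((\<lambda>t. - (1 / T) * ?u t x + (1 - t / T) * laplacian w m (?u t) x) has_integral
        ?g x T - ?g x 0) {0..T}"
      using \<open>T > 0\<close>
      by (intro fundamental_theorem_of_calculus)
         (auto intro!: derivative_eq_intros DERIV_subset[OF heat_equation]
            simp flip: has_real_derivative_iff_has_vector_derivative)
    from has_integral_add[OF this has_integral_mult_right[OF I[of x], of "1 / T"]]
    show "((\<lambda>t. (1 - t / T) * laplacian w m (?u t) x) has_integral - W x + I x / T) {0..T}"
      using \<open>T > 0\<close> by (simp add: heat_zero)
  qed
  show thesis
  proof
    define \<phi> where "\<phi> x = 1 - 2 * k + 2 * \<psi> x" for x
    show "1 - 2 * k \<le> \<phi> x" "\<phi> x \<le> 1" for x
      using \<psi>_nonneg[of x] \<psi>_le[of x] by (auto simp: \<phi>_def)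
    then have "2 * W x * \<phi> x \<le> 2 * W x" for x
      using W[of x] by (simp add: mult_left_le)
    moreover have "laplacian w m \<phi> x = 2 * (- W x + I x / T)" for x
      using laplacian_affine_combination[of w m "1 - 2 * k" 2 \<psi> 0 \<psi> x]
      unfolding \<phi>_def by (simp add: lap)
    moreover have "2 * (I x / T) \<le> 2 * k / T" for x
      using divide_right_mono[OF I_le[of x], of T] \<open>T > 0\<close> by simp
    ultimately show "laplacian w m \<phi> x + 2 * W x * \<phi> x \<le> 2 * k / T" for x
      using add_mono[of "2 * (I x / T)" "2 * k / T" "2 * W x * \<phi> x" "2 * W x"] by simp
  qed
qed

section \<open>Gradient estimate for eigenfunctions\<close>

text \<open>At a maximum of \<open>f\<^sup>2\<close> the identity \<open>2 \<Gamma> f = \<Delta> f\<^sup>2 + 2 \<lambda> f\<^sup>2\<close> has a nonnegative left-hand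
  side and a nonpositive first summand on the right.\<close>

lemma eigenvalue_nonneg:
  fixes w :: "'v::finite \<Rightarrow> 'v \<Rightarrow> real"
  assumes G: "mwg w m" and ev: "eigenfunction w m l f"
  shows "l \<ge> 0"
proof -
  obtain x where x: "\<And>y. (f y)\<^sup>2 \<le> (f x)\<^sup>2"
    using finite_type_attains_max[of "\<lambda>y. (f y)\<^sup>2"] by blast
  have "f x \<noteq> 0"
    using ev x unfolding eigenfunction_def by (auto simp: fun_eq_iff)
  have "laplacian w m (\<lambda>z. f z * f z) x \<le> 0"
    using laplacian_at_max_nonpos[OF G] x by (simp add: power2_eq_square)
  moreover have "laplacian w m f x = - l * f x"
    using ev unfolding eigenfunction_def neg_laplacian_def by (simp add: fun_eq_iff equation_minus_iff)
  ultimately have "l * (f x)\<^sup>2 \<ge> 0"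
    using Gamma_form_self_nonneg[OF G, of f x]
    by (simp add: Gamma_form_def power2_eq_square mult_ac)
  then show ?thesis
    using \<open>f x \<noteq> 0\<close> by (simp add: zero_le_mult_iff)
qed

text \<open>At a maximum \<open>z\<close> of \<open>u / \<phi>\<close>, with value \<open>c\<close>, the function \<open>c \<phi>\<close> touches \<open>u\<close> from above.
  There \<open>\<Delta> u \<le> c \<Delta> \<phi> \<le> c \<epsilon> - V u\<close>, so the potential cancels from the inequality for \<open>u\<close>
  however large \<open>V\<close> is.\<close>

lemma supersolution_comparison:
  fixes w :: "'v::finite \<Rightarrow> 'v \<Rightarrow> real"
  assumes G: "mwg w m"
    and \<phi>: "\<And>x. a \<le> \<phi> x" "\<And>x. \<phi> x \<le> 1" "a > 0"
      "\<And>x. laplacian w m \<phi> x + V x * \<phi> x \<le> \<epsilon>"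
    and u: "\<And>x. u x \<ge> 0" "\<And>x. (\<beta> - V x) * u x - laplacian w m u x \<le> B"
    and "\<beta> \<ge> 0" and gap: "\<beta> * a - \<epsilon> > 0"
  shows "u x \<le> B / (\<beta> * a - \<epsilon>)"
proof -
  have pos: "\<phi> y > 0" for y using \<phi>(1)[of y] \<open>a > 0\<close> by simp
  obtain z where z: "\<And>y. u y / \<phi> y \<le> u z / \<phi> z"
    using finite_type_attains_max[of "\<lambda>y. u y / \<phi> y"] by blast
  define c where "c = u z / \<phi> z"
  have c: "c \<ge> 0" "u z = c * \<phi> z"
    using pos[of z] u(1)[of z] by (auto simp: c_def)
  have le: "u y \<le> c * \<phi> y" for y
    using z[of y] pos[of y] unfolding c_def[symmetric] by (simp add: pos_divide_le_eq)
  have "laplacian w m u z \<le> laplacian w m (\<lambda>y. c * \<phi> y) z"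
    using c(2) le by (intro laplacian_le_at_contact_point[OF G]) auto
  also have "\<dots> = c * laplacian w m \<phi> z"
    using laplacian_affine_combination[of w m 0 c \<phi> 0 \<phi> z] by simp
  also have "\<dots> \<le> c * (\<epsilon> - V z * \<phi> z)"
    using \<phi>(4)[of z] c(1) by (intro mult_left_mono) auto
  finally have "\<beta> * (c * \<phi> z) - c * \<epsilon> \<le> B"
    using u(2)[of z] by (simp add: c(2) algebra_simps)
  moreover have "\<beta> * (c * a) \<le> \<beta> * (c * \<phi> z)"
    using \<open>\<beta> \<ge> 0\<close> c(1) \<phi>(1) by (intro mult_left_mono) auto
  ultimately have "c * (\<beta> * a - \<epsilon>) \<le> B"
    by (simp add: algebra_simps)
  then have "c \<le> B / (\<beta> * a - \<epsilon>)"
    using gap by (simp add: pos_le_divide_eq)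
  moreover have "u x \<le> c"
    using le[of x] mult_left_le[OF \<phi>(2)[of x] c(1)] by simp
  ultimately show ?thesis by simp
qed

text \<open>For an eigenfunction the mixed term of \<open>\<Gamma>\<^sub>2\<close> is \<open>\<Gamma>(f, \<Delta> f) = - \<lambda> \<Gamma> f\<close>, so the
  curvature condition becomes a differential inequality for \<open>\<Gamma> f\<close> alone once the nonnegative
  dimension term is dropped.\<close>

lemma eigenfunction_bochner:
  fixes w :: "'v::finite \<Rightarrow> 'v \<Rightarrow> real"
  assumes "n > 0" and cd: "CD w m \<rho> n"
    and ev: "eigenfunction w m l f"
  shows "laplacian w m (Gamma_form w m f f) x \<ge> 2 * (\<rho> x - l) * Gamma_form w m f f x"
    and "laplacian w m (\<lambda>z. (f z)\<^sup>2) x = 2 * Gamma_form w m f f x - 2 * l * (f x)\<^sup>2"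
proof -
  have lf: "laplacian w m f = (\<lambda>x. - l * f x)"
    using ev unfolding eigenfunction_def neg_laplacian_def by (simp add: fun_eq_iff equation_minus_iff)
  have lin: "laplacian w m (\<lambda>z. - (l * g z)) x = - l * laplacian w m g x" for g x
    using laplacian_affine_combination[of w m 0 "- l" g 0 g x] by simp
  have "Gamma_form w m f (laplacian w m f) x = - l * Gamma_form w m f f x"
    using lin[of "\<lambda>z. f z * f z"] lin[of f]
    by (simp add: Gamma_form_def lf mult.left_commute) (simp add: algebra_simps)
  moreover have "real_of_ereal (1 / n) * (laplacian w m f x)\<^sup>2 \<ge> 0"
    using \<open>n > 0\<close> by (intro mult_nonneg_nonneg real_of_ereal_pos) simp_all
  moreover have "Gamma2_form w m f f x
      \<ge> \<rho> x * Gamma_form w m f f x + real_of_ereal (1 / n) * (laplacian w m f x)\<^sup>2"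
    using cd unfolding CD_def by (simp add: finite_imp_bounded)
  ultimately have "\<rho> x * Gamma_form w m f f x
      \<le> (1/2) * laplacian w m (Gamma_form w m f f) x + l * Gamma_form w m f f x"
    unfolding Gamma2_form_def by simp
  then show "laplacian w m (Gamma_form w m f f) x \<ge> 2 * (\<rho> x - l) * Gamma_form w m f f x"
    by (simp add: algebra_simps)
  show "laplacian w m (\<lambda>z. (f z)\<^sup>2) x = 2 * Gamma_form w m f f x - 2 * l * (f x)\<^sup>2"
    by (simp add: Gamma_form_def lf power2_eq_square field_simps)
qed

theorem corollary4p3:
  fixes w :: "'v::finite \<Rightarrow> 'v \<Rightarrow> real" and m \<rho> :: "'v \<Rightarrow> real"
    and K T :: real and n :: ereal and l :: real and f :: "'v \<Rightarrow> real"
  assumes "K > 0" and "T > 0" and "n > 0"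
    and "mwg w m"
    and "CD w m \<rho> n"
    and "kato w m T (\<lambda>x. neg_part (\<rho> x - K)) \<le> ennreal (1/4 * (1 - exp (- (K * T / 2))))"
    and "eigenfunction w m l f"
  shows "sup_norm (Gamma_form w m f f) \<le> 2 * exp (1 + T * K) * l * (sup_norm f)\<^sup>2"
proof -
  note G = \<open>mwg w m\<close>
  define W where "W x = neg_part (\<rho> x - K)" for x
  define y where "y = exp (- (K * T / 2))"
  define k where "k = 1/4 * (1 - y)"
  let ?g = "Gamma_form w m f f"
  let ?M = "(sup_norm f)\<^sup>2"
  have W: "W x \<ge> 0" "\<rho> x \<ge> K - W x" for x
    by (auto simp: W_def neg_part_def min_def)
  have y: "0 < y" "y \<le> 1" using \<open>K > 0\<close> \<open>T > 0\<close> by (auto simp: y_def)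
  have "k \<ge> 0" using y by (simp add: k_def)
  have "1 - y \<le> K * T / 2"
    using exp_ge_add_one_self[of "- (K * T / 2)"] by (simp add: y_def)
  then have kT: "2 * k / T \<le> K / 4"
    using \<open>T > 0\<close> by (simp add: k_def field_simps)
  have kato: "kato w m T W \<le> ennreal k"
    using assms(6) unfolding W_def k_def y_def .
  obtain \<phi> where \<phi>: "\<And>x. 1 - 2 * k \<le> \<phi> x" "\<And>x. \<phi> x \<le> 1"
      "\<And>x. laplacian w m \<phi> x + 2 * W x * \<phi> x \<le> 2 * k / T"
    using kato_supersolution[OF G W(1) \<open>T > 0\<close> \<open>k \<ge> 0\<close> kato] by blast
  have l: "l \<ge> 0" using eigenvalue_nonneg[OF G assms(7)] .
  note bochner = eigenfunction_bochner[OF assms(3,5,7)]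
  have g: "?g x \<ge> 0" for x using Gamma_form_self_nonneg[OF G] .
  have f: "(f x)\<^sup>2 \<le> ?M" for x
    using power_mono[OF abs_le_sup_norm[of f x], of 2] by simp
  \<comment> \<open>The multiple \<open>2 * l\<close> is chosen large enough that \<open>\<beta> = 2 * K + 2 * l\<close> grows with \<open>l\<close>, as needed
    for a final bound that is linear in \<open>l\<close>.\<close>
  define u where "u x = ?g x + 2 * l * (f x)\<^sup>2" for x
  define \<beta> where "\<beta> = 2 * K + 2 * l"
  define B where "B = 4 * l * (K + 2 * l) * ?M"
  define D where "D = \<beta> * (1 - 2 * k) - 2 * k / T"
  have u: "u x \<ge> ?g x" "u x \<ge> 0" for x
    using g[of x] l by (auto simp: u_def)
  have sub: "(\<beta> - 2 * W x) * u x - laplacian w m u x \<le> B" for x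
  proof -
    have "laplacian w m u x
        = laplacian w m ?g x + 2 * l * (2 * ?g x - 2 * l * (f x)\<^sup>2)"
      using laplacian_affine_combination[of w m 0 1 ?g "2 * l" "\<lambda>z. (f z)\<^sup>2" x]
      unfolding u_def by (simp add: bochner(2))
    moreover have "2 * (K - W x - l) * ?g x \<le> 2 * (\<rho> x - l) * ?g x"
      using W(2)[of x] g[of x] by (intro mult_right_mono) auto
    ultimately have "(\<beta> - 2 * W x) * u x - laplacian w m u x
        \<le> 4 * l * (K + 2 * l - W x) * (f x)\<^sup>2"
      using bochner(1)[of x] by (simp add: u_def \<beta>_def algebra_simps power2_eq_square)
    also have "\<dots> \<le> 4 * l * (K + 2 * l) * (f x)\<^sup>2"
      using W(1)[of x] l by (intro mult_right_mono mult_left_mono) auto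
    also have "\<dots> \<le> B"
      unfolding B_def using f[of x] l \<open>K > 0\<close> by (intro mult_left_mono) auto
    finally show ?thesis .
  qed
  have D: "(K + 2 * l) * y\<^sup>2 \<le> D"
  proof -
    \<comment> \<open>Since \<open>1 - 2 k = (1 + y) / 2\<close> and \<open>2 k / T \<le> K / 4\<close>, it is enough to compare the coefficients
      of \<open>K\<close> and \<open>l\<close>.\<close>
    have "y\<^sup>2 \<le> y" using y by (simp add: power2_eq_square mult_left_le)
    then have "K * y\<^sup>2 \<le> K * (3/4 + y)" "l * (2 * y\<^sup>2) \<le> l * (1 + y)"
      using y \<open>K > 0\<close> l by (auto intro!: mult_left_mono)
    then have "(K + 2 * l) * y\<^sup>2 \<le> (K + l) * (1 + y) - K / 4"
      by (simp add: algebra_simps)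
    also have "\<dots> = \<beta> * (1 - 2 * k) - K / 4"
      by (simp add: \<beta>_def k_def field_simps)
    also have "\<dots> \<le> D"
      using kT by (simp add: D_def)
    finally show ?thesis .
  qed
  have "(K + 2 * l) * y\<^sup>2 > 0" using \<open>K > 0\<close> l y by simp
  have "?g x \<le> 2 * exp (1 + T * K) * l * ?M" for x
  proof -
    have "?g x \<le> u x" by (rule u(1))
    also have "\<dots> \<le> B / D"
      unfolding D_def
    proof (rule supersolution_comparison[where V = "\<lambda>x. 2 * W x", OF G \<phi>(1,2) _ \<phi>(3) u(2) sub])
      show "1 - 2 * k > 0" using y by (simp add: k_def)
      show "\<beta> \<ge> 0" using \<open>K > 0\<close> l by (simp add: \<beta>_def)
      show "\<beta> * (1 - 2 * k) - 2 * k / T > 0"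
        using D \<open>(K + 2 * l) * y\<^sup>2 > 0\<close> by (simp add: D_def)
    qed
    also have "\<dots> \<le> B / ((K + 2 * l) * y\<^sup>2)"
      using D \<open>(K + 2 * l) * y\<^sup>2 > 0\<close> l \<open>K > 0\<close>
      by (intro divide_left_mono) (auto simp: B_def)
    also have "\<dots> = 4 * exp (T * K) * l * ?M"
    proof -
      have "exp (T * K) * y\<^sup>2 = 1"
        by (simp add: y_def power2_eq_square algebra_simps flip: exp_add)
      then have "B = 4 * l * (K + 2 * l) * ?M * (exp (T * K) * y\<^sup>2)"
        by (simp add: B_def)
      also have "\<dots> = 4 * exp (T * K) * l * ?M * ((K + 2 * l) * y\<^sup>2)"
        by (simp only: mult_ac)
      finally show ?thesis
        using \<open>(K + 2 * l) * y\<^sup>2 > 0\<close> by (metis nonzero_mult_div_cancel_right less_irrefl)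
    qed
    also have "\<dots> \<le> 2 * exp (1 + T * K) * l * ?M"
      using exp_ge_add_one_self[of 1] l
      by (intro mult_right_mono) (auto simp: exp_add)
    finally show ?thesis .
  qed
  then show ?thesis
    unfolding sup_norm_def[of ?g] using g by (intro cSUP_least) auto
qed

end
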